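(* For $i=1,2$, let $(X_i,\tau_i)$ be a zero-dimensional Hausdorff space, let $(Y_i,f_i)$ be a zero-dimensional Hausdorff local compactification of $(X_i,\tau_i)$, and let $A_i=\{f_i^{-1}(U) : U\in CO(Y_i)\}$ and $I_i=\{f_i^{-1}(U) : U\in CK(Y_i)\}$. Let $f:X_1\to X_2$ be a function. Then there exists a continuous function $g:Y_1\to Y_2$ such that $g\circ f_1=f_2\circ f$ if and only if $f$ satisfies the following two conditions: (ZEQ1) for every $G\in A_2$, $f^{-1}(G)\in A_1$; (ZEQ2) for every $F\in I_1$ there exists $G\in I_2$ such that $f(F)\subseteq G$.
   Context: A space is zero-dimensional if it has a base of clopen sets. A zero-dimensional Hausdorff local compactification of $X$ is a pair $(Y,f)$ where $Y$ is a zero-dimensional locally compact Hausdorff space and $f:X\to Y$ is a homeomorphic embedding with dense image. $CO(Y)$ is the set of all clopen subsets of $Y$ and $CK(Y)$ the set of all compact clopen subsets of $Y$. *)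

theory Defs
  imports "HOL-Analysis.Analysis"
begin

text \<open>Spaces are abstract topologies, whose points form the carrier \<open>topspace X\<close> rather than the
  whole type; inverse images and equalities of maps are therefore relativised to the carrier.\<close>

definition CO :: "'a topology \<Rightarrow> 'a set set"
  where "CO Y = {U. openin Y U \<and> closedin Y U}"

definition CK :: "'a topology \<Rightarrow> 'a set set"
  where "CK Y = {U. U \<in> CO Y \<and> compactin Y U}"

text \<open>A family \<open>\<B>\<close> is a base of \<open>X\<close> if the open sets of \<open>X\<close> are exactly the unions of subfamilies
  of \<open>\<B>\<close>.\<close>

definition zero_dimensional :: "'a topology \<Rightarrow> bool"
  where "zero_dimensional X \<longleftrightarrow>
    (\<exists>\<B>. \<B> \<subseteq> CO X \<and> openin X = arbitrary union_of (\<lambda>B. B \<in> \<B>))"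

text \<open>\<open>embedding_map X Y f\<close> includes that \<open>f\<close> maps \<open>topspace X\<close> into \<open>topspace Y\<close>.\<close>

definition zd_Hausdorff_local_compactification ::
    "'a topology \<Rightarrow> 'b topology \<Rightarrow> ('a \<Rightarrow> 'b) \<Rightarrow> bool"
  where "zd_Hausdorff_local_compactification X Y f \<longleftrightarrow>
    zero_dimensional Y \<and> locally_compact_space Y \<and> Hausdorff_space Y \<and>
    embedding_map X Y f \<and> Y closure_of (f ` topspace X) = topspace Y"

end

theory Submission
  imports Defs
begin

text \<open>The condition \<open>(ZEQ1)\<close> transports clopen sets of \<open>Y2\<close> to clopen sets of \<open>Y1\<close> having the same
  trace along \<open>f\<close>. A point \<open>y\<close> of \<open>Y1\<close> thus determines the ultrafilter of those clopen \<open>V\<close> in \<open>Y2\<close>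
  whose transport contains \<open>y\<close>. As \<open>y\<close> has a compact clopen neighbourhood, \<open>(ZEQ2)\<close> puts a compact
  set in this ultrafilter, so it converges, and its limit is the value at \<open>y\<close> of the extension.\<close>

lemma zero_dimensional_clopen_nbhd:
  assumes "zero_dimensional Y" "openin Y W" "y \<in> W"
  obtains B where "B \<in> CO Y" "y \<in> B" "B \<subseteq> W"
proof -
  from assms obtain \<B> where \<B>: "\<B> \<subseteq> CO Y" "openin Y = arbitrary union_of (\<lambda>B. B \<in> \<B>)"
    unfolding zero_dimensional_def by blast
  have "(arbitrary union_of (\<lambda>B. B \<in> \<B>)) W"
    using assms(2) \<B>(2) by simp
  then obtain \<U> where "\<U> \<subseteq> \<B>" "\<Union>\<U> = W"
    by (auto simp: union_of_def arbitrary_def)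
  then show thesis
    using that assms(3) \<B>(1) by blast
qed

lemma zero_dimensional_separates:
  assumes "zero_dimensional Y" "Hausdorff_space Y" "y \<in> topspace Y" "z \<in> topspace Y" "y \<noteq> z"
  obtains V where "V \<in> CO Y" "y \<in> V" "z \<notin> V"
proof -
  obtain U where U: "openin Y U" "y \<in> U" "z \<notin> U"
    using assms(2-5) unfolding Hausdorff_space_def disjnt_iff by metis
  show thesis
    using zero_dimensional_clopen_nbhd[OF assms(1) U(1,2)] that U(3) by blast
qed

text \<open>A clopen set inside a compact neighbourhood is closed in a compact set, hence itself
  compact.\<close>

lemma CK_nbhd:
  assumes "zero_dimensional Y" "locally_compact_space Y" "y \<in> topspace Y"
  obtains K where "K \<in> CK Y" "y \<in> K"
proof -
  obtain U C where UC: "openin Y U" "compactin Y C" "y \<in> U" "U \<subseteq> C"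
    using assms(2,3) unfolding locally_compact_space_def by blast
  obtain B where B: "B \<in> CO Y" "y \<in> B" "B \<subseteq> U"
    using zero_dimensional_clopen_nbhd[OF assms(1) UC(1,3)] by blast
  have "compactin Y B"
    using closed_compactin[OF UC(2)] B UC(4) by (auto simp: CO_def)
  then show thesis
    using that B by (auto simp: CK_def)
qed

lemma Union_in_CK:
  assumes "finite \<F>" "\<F> \<subseteq> CK Y"
  shows "\<Union>\<F> \<in> CK Y"
  using assms by (auto simp: CK_def CO_def subset_iff intro: compactin_Union closedin_Union)

text \<open>Compact clopen neighbourhoods of its points cover \<open>S\<close>, and finite unions of
  them stay compact clopen. This enlarges a compact image, which need not be open, to a set of the
  kind that (ZEQ2) asks for.\<close>

lemma compactin_subset_CK:
  assumes "zero_dimensional Y" "locally_compact_space Y" "compactin Y S"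
  obtains L where "L \<in> CK Y" "S \<subseteq> L"
proof -
  have "S \<subseteq> \<Union>(CK Y)"
    using CK_nbhd[OF assms(1,2)] compactin_subset_topspace[OF assms(3)] by blast
  moreover have "\<forall>K\<in>CK Y. openin Y K"
    by (auto simp: CK_def CO_def)
  ultimately obtain \<F> where "finite \<F>" "\<F> \<subseteq> CK Y" "S \<subseteq> \<Union>\<F>"
    using assms(3) unfolding compactin_def by metis
  then show thesis
    using that Union_in_CK by blast
qed

lemma dense_meets_open:
  assumes "Y closure_of D = topspace Y" "openin Y S" "y \<in> S"
  obtains d where "d \<in> D" "d \<in> S"
  using assms openin_subset[OF assms(2)] by (metis in_closure_of subsetD)

lemma continuous_map_vimage_CO:
  assumes "continuous_map X Y g" "V \<in> CO Y"
  shows "g -` V \<inter> topspace X \<in> CO X"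
proof -
  have "g -` V \<inter> topspace X = {x \<in> topspace X. g x \<in> V}"
    by blast
  then show ?thesis
    using assms openin_continuous_map_preimage closedin_continuous_map_preimage
    by (auto simp: CO_def)
qed

text \<open>Clopen sets form a base of \<open>Y\<close>, so their preimages decide continuity. For
  the extension built from \<phi>, these preimages are the ones directly known.\<close>

lemma continuous_map_into_zero_dimensional:
  assumes "zero_dimensional Y" "g \<in> topspace X \<rightarrow> topspace Y"
    and "\<And>V. V \<in> CO Y \<Longrightarrow> openin X {x \<in> topspace X. g x \<in> V}"
  shows "continuous_map X Y g"
  unfolding continuous_map_def
proof (intro conjI allI impI)
  fix W assume W: "openin Y W"
  show "openin X {x \<in> topspace X. g x \<in> W}"
  proof (subst openin_subopen, intro ballI)
    fix x assume "x \<in> {x \<in> topspace X. g x \<in> W}"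
    then obtain B where "B \<in> CO Y" "g x \<in> B" "B \<subseteq> W" "x \<in> topspace X"
      using zero_dimensional_clopen_nbhd[OF assms(1) W] by blast
    then show "\<exists>T. openin X T \<and> x \<in> T \<and> T \<subseteq> {x \<in> topspace X. g x \<in> W}"
      using assms(3)[of B] by blast
  qed
qed (fact assms(2))

text \<open>Density turns \<open>trace\<close> into the Boolean laws required of \<phi>: any
  nonempty open set of \<open>Y1\<close> contains some \<open>e x\<close>, where membership in
  \<phi> \<open>V\<close> becomes membership of \<open>h x\<close> in \<open>V\<close>. The compact
  set \<open>L\<close> then supplies the limit point.\<close>

lemma ultrafilter_limit:
  fixes e :: "'a \<Rightarrow> 'c" and h :: "'a \<Rightarrow> 'd"
  assumes dense: "Y1 closure_of (e ` S) = topspace Y1"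
    and \<phi>: "\<And>V. V \<in> CO Y2 \<Longrightarrow> \<phi> V \<in> CO Y1"
    and trace: "\<And>V x. V \<in> CO Y2 \<Longrightarrow> x \<in> S \<Longrightarrow> e x \<in> \<phi> V \<longleftrightarrow> h x \<in> V"
    and h: "h \<in> S \<rightarrow> topspace Y2"
    and K: "openin Y1 K" "y \<in> K" and L: "compactin Y2 L"
    and KL: "\<And>x. x \<in> S \<Longrightarrow> e x \<in> K \<Longrightarrow> h x \<in> L"
  shows "\<exists>p\<in>topspace Y2. \<forall>V\<in>CO Y2. p \<in> V \<longleftrightarrow> y \<in> \<phi> V"
proof -
  have \<phi>_compl: "y \<in> \<phi> (topspace Y2 - V)" if V: "V \<in> CO Y2" "y \<notin> \<phi> V" for V
  proof (rule ccontr)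
    assume n: "y \<notin> \<phi> (topspace Y2 - V)"
    have V': "topspace Y2 - V \<in> CO Y2"
      using V(1) by (auto simp: CO_def)
    \<comment> \<open>This difference is open because both transports are closed, and it contains
      \<open>y\<close>. A point \<open>e x\<close> in it would put \<open>h x\<close> outside both
      \<open>V\<close> and its complement.\<close>
    have "openin Y1 (K - \<phi> V - \<phi> (topspace Y2 - V))"
      using \<phi>[OF V(1)] \<phi>[OF V'] K by (auto simp: CO_def)
    from dense_meets_open[OF dense this, of y] obtain x where
      "x \<in> S" "e x \<notin> \<phi> V" "e x \<notin> \<phi> (topspace Y2 - V)"
      using K(2) V(2) n by blast
    then show False
      using trace[OF V(1)] trace[OF V'] h by blast
  qed
  have "\<exists>p\<in>L. \<forall>V\<in>CO Y2. y \<in> \<phi> V \<longrightarrow> p \<in> V"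
  proof (rule ccontr)
    assume n: "\<not> ?thesis"
    \<comment> \<open>If no point of \<open>L\<close> lies in all members of the ultrafilter, their
      complements form an open cover of \<open>L\<close>.\<close>
    define \<U> where "\<U> = {topspace Y2 - V | V. V \<in> CO Y2 \<and> y \<in> \<phi> V}"
    have "L \<subseteq> \<Union>\<U>"
    proof
      fix p assume p: "p \<in> L"
      then obtain V where "V \<in> CO Y2" "y \<in> \<phi> V" "p \<notin> V"
        using n by blast
      moreover from this have "topspace Y2 - V \<in> \<U>" "p \<in> topspace Y2 - V"
        using compactin_subset_topspace[OF L] p unfolding \<U>_def by blast+
      ultimately show "p \<in> \<Union>\<U>"
        by blast
    qed
    moreover have "\<forall>U\<in>\<U>. openin Y2 U"
      by (auto simp: \<U>_def CO_def)
    ultimately obtain \<F> where \<F>: "finite \<F>" "\<F> \<subseteq> \<U>" "L \<subseteq> \<Union>\<F>"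
      using L unfolding compactin_def by metis
    \<comment> \<open>Complementing again recovers the finitely many ultrafilter members behind the
      subcover.\<close>
    define \<G> where "\<G> = (\<lambda>U. topspace Y2 - U) ` \<F>"
    have \<G>: "finite \<G>" "\<And>V. V \<in> \<G> \<Longrightarrow> V \<in> CO Y2 \<and> y \<in> \<phi> V"
    proof -
      show "V \<in> CO Y2 \<and> y \<in> \<phi> V" if "V \<in> \<G>" for V
      proof -
        from that obtain W where "V = topspace Y2 - (topspace Y2 - W)" "W \<in> CO Y2" "y \<in> \<phi> W"
          using \<F>(2) by (auto simp: \<G>_def \<U>_def)
        moreover from this have "V = W"
          using openin_subset[of Y2 W] by (auto simp: CO_def)
        ultimately show ?thesis
          by simp
      qed
    qed (simp add: \<G>_def \<F>(1))
    \<comment> \<open>A finite intersection of open neighbourhoods of \<open>y\<close> meets the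
      dense image. The resulting \<open>h x\<close> lies in \<open>L\<close>, by \<open>KL\<close>,
      and in every member of \<G>, so the subcover misses it.\<close>
    have "openin Y1 (\<Inter>(insert K (\<phi> ` \<G>)))"
      using \<G> \<phi> K(1) by (intro openin_Inter) (auto simp: CO_def)
    moreover have "y \<in> \<Inter>(insert K (\<phi> ` \<G>))"
      using K(2) \<G>(2) by blast
    ultimately obtain d where "d \<in> e ` S" "d \<in> \<Inter>(insert K (\<phi> ` \<G>))"
      by (rule dense_meets_open[OF dense])
    then obtain x where x: "x \<in> S" "e x \<in> K" "\<And>V. V \<in> \<G> \<Longrightarrow> e x \<in> \<phi> V"
      by auto
    obtain U where U: "U \<in> \<F>" "h x \<in> U"
      using KL[OF x(1,2)] \<F>(3) by blast
    then have V: "topspace Y2 - U \<in> \<G>"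
      by (simp add: \<G>_def)
    have "h x \<in> topspace Y2 - U"
      using trace[OF conjunct1[OF \<G>(2)[OF V]] x(1)] x(3)[OF V] by (rule iffD1)
    then show False
      using U(2) by simp
  qed
  then obtain p where p: "p \<in> L" "\<And>V. V \<in> CO Y2 \<Longrightarrow> y \<in> \<phi> V \<Longrightarrow> p \<in> V"
    by blast
  \<comment> \<open>Maximality gives the converse: otherwise the complement of \<open>V\<close>
    belongs to the ultrafilter and must contain \<open>p\<close>.\<close>
  moreover have "y \<in> \<phi> V" if V: "V \<in> CO Y2" "p \<in> V" for V
  proof (rule ccontr)
    assume "y \<notin> \<phi> V"
    moreover have "topspace Y2 - V \<in> CO Y2"
      using V(1) by (auto simp: CO_def)
    ultimately show False
      using \<phi>_compl[OF V(1)] p(2) V(2) by blast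
  qed
  moreover have "p \<in> topspace Y2"
    using p(1) compactin_subset_topspace[OF L] by blast
  ultimately show ?thesis
    by metis
qed

theorem theorem4p1:
  fixes X1 :: "'a topology" and X2 :: "'b topology"
    and Y1 :: "'c topology" and Y2 :: "'d topology"
    and f1 :: "'a \<Rightarrow> 'c" and f2 :: "'b \<Rightarrow> 'd"
    and f :: "'a \<Rightarrow> 'b"
    and A1 I1 :: "'a set set" and A2 I2 :: "'b set set"
  assumes "zero_dimensional X1" and "Hausdorff_space X1"
    and "zero_dimensional X2" and "Hausdorff_space X2"
    and "zd_Hausdorff_local_compactification X1 Y1 f1"
    and "zd_Hausdorff_local_compactification X2 Y2 f2"
    and "A1 = {f1 -` U \<inter> topspace X1 | U. U \<in> CO Y1}"
    and "I1 = {f1 -` U \<inter> topspace X1 | U. U \<in> CK Y1}"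
    and "A2 = {f2 -` U \<inter> topspace X2 | U. U \<in> CO Y2}"
    and "I2 = {f2 -` U \<inter> topspace X2 | U. U \<in> CK Y2}"
    and "f \<in> topspace X1 \<rightarrow> topspace X2"
  shows "(\<exists>g. continuous_map Y1 Y2 g \<and> (\<forall>x\<in>topspace X1. g (f1 x) = f2 (f x)))
     \<longleftrightarrow> (\<forall>G\<in>A2. f -` G \<inter> topspace X1 \<in> A1) \<and> (\<forall>F\<in>I1. \<exists>G\<in>I2. f ` F \<subseteq> G)"
proof -
  have Y1: "zero_dimensional Y1" "locally_compact_space Y1"
    and dense: "Y1 closure_of (f1 ` topspace X1) = topspace Y1"
    and f1: "f1 \<in> topspace X1 \<rightarrow> topspace Y1"
    using assms(5)
    by (auto simp: zd_Hausdorff_local_compactification_def embedding_map_def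
        dest!: homeomorphic_imp_continuous_map continuous_map_image_subset_topspace)
  have Y2: "zero_dimensional Y2" "locally_compact_space Y2" "Hausdorff_space Y2"
    and f2: "f2 \<in> topspace X2 \<rightarrow> topspace Y2"
    using assms(6)
    by (auto simp: zd_Hausdorff_local_compactification_def embedding_map_def
        dest!: homeomorphic_imp_continuous_map continuous_map_image_subset_topspace)
  note f = assms(11)
  show ?thesis
  proof (intro iffI; (elim exE conjE)?)
    fix g assume g: "continuous_map Y1 Y2 g" and gf: "\<forall>x\<in>topspace X1. g (f1 x) = f2 (f x)"
    show "(\<forall>G\<in>A2. f -` G \<inter> topspace X1 \<in> A1) \<and> (\<forall>F\<in>I1. \<exists>G\<in>I2. f ` F \<subseteq> G)"
    proof (intro conjI ballI)
      fix G assume "G \<in> A2"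
      then obtain V where V: "V \<in> CO Y2" "G = f2 -` V \<inter> topspace X2"
        using assms(9) by blast
      \<comment> \<open>The clopen set of \<open>Y1\<close> witnessing (ZEQ1) is the preimage of
        \<open>V\<close> under \<open>g\<close>.\<close>
      have "f -` G \<inter> topspace X1 = f1 -` (g -` V \<inter> topspace Y1) \<inter> topspace X1"
        using V(2) gf f f1 by auto
      then show "f -` G \<inter> topspace X1 \<in> A1"
        using continuous_map_vimage_CO[OF g V(1)] assms(7) by blast
    next
      fix F assume "F \<in> I1"
      then obtain K where K: "K \<in> CK Y1" "F = f1 -` K \<inter> topspace X1"
        using assms(8) by blast
      have "compactin Y2 (g ` K)"
        using image_compactin[OF _ g] K(1) by (simp add: CK_def)
      then obtain L where "L \<in> CK Y2" "g ` K \<subseteq> L"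
        using compactin_subset_CK[OF Y2(1,2)] by blast
      moreover from this have "f ` F \<subseteq> f2 -` L \<inter> topspace X2"
        using K(2) f gf by force
      ultimately show "\<exists>G\<in>I2. f ` F \<subseteq> G"
        using assms(10) by blast
    qed
  next
    assume zeq1: "\<forall>G\<in>A2. f -` G \<inter> topspace X1 \<in> A1"
      and zeq2: "\<forall>F\<in>I1. \<exists>G\<in>I2. f ` F \<subseteq> G"
    define h where "h x = f2 (f x)" for x
    have h: "h \<in> topspace X1 \<rightarrow> topspace Y2"
      using f f2 by (auto simp: h_def)
    \<comment> \<open>(ZEQ1) read pointwise; choosing one \<open>U\<close> for each \<open>V\<close>
      yields the transport \<phi>.\<close>
    have "\<exists>U\<in>CO Y1. \<forall>x\<in>topspace X1. f1 x \<in> U \<longleftrightarrow> h x \<in> V" if V: "V \<in> CO Y2" for V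
    proof -
      have "f2 -` V \<inter> topspace X2 \<in> A2"
        using V assms(9) by blast
      then obtain U where U: "U \<in> CO Y1"
        and eq: "f -` (f2 -` V \<inter> topspace X2) \<inter> topspace X1 = f1 -` U \<inter> topspace X1"
        using zeq1 assms(7) by fast
      have "f1 x \<in> U \<longleftrightarrow> h x \<in> V" if "x \<in> topspace X1" for x
        using that eq f by (auto simp: h_def set_eq_iff)
      then show ?thesis
        using U by blast
    qed
    then obtain \<phi> where \<phi>: "\<And>V. V \<in> CO Y2 \<Longrightarrow> \<phi> V \<in> CO Y1"
      and trace: "\<And>V x. V \<in> CO Y2 \<Longrightarrow> x \<in> topspace X1 \<Longrightarrow> f1 x \<in> \<phi> V \<longleftrightarrow> h x \<in> V"
      by metis
    have "\<exists>p\<in>topspace Y2. \<forall>V\<in>CO Y2. p \<in> V \<longleftrightarrow> y \<in> \<phi> V" if y: "y \<in> topspace Y1" for y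
    proof -
      \<comment> \<open>The trace of \<open>K\<close> on \<open>X1\<close> lies in
        \<open>I1\<close>, so (ZEQ2) encloses its image under \<open>f\<close> in the trace of a
        compact \<open>L\<close>. This is the compactness needed for convergence at
        \<open>y\<close>.\<close>
      obtain K where K: "K \<in> CK Y1" "y \<in> K"
        using CK_nbhd[OF Y1 y] by blast
      then have "f1 -` K \<inter> topspace X1 \<in> I1"
        using assms(8) by blast
      then obtain G where G: "G \<in> I2" "f ` (f1 -` K \<inter> topspace X1) \<subseteq> G"
        using zeq2 by meson
      then obtain L where L: "L \<in> CK Y2" "G = f2 -` L \<inter> topspace X2"
        using assms(10) by blast
      have KL: "openin Y1 K" "compactin Y2 L"
        using K L by (auto simp: CK_def CO_def)
      have hL: "h x \<in> L" if "x \<in> topspace X1" "f1 x \<in> K" for x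
        using that G(2) L(2) by (auto simp: h_def)
      show ?thesis
        by (rule ultrafilter_limit[OF dense \<phi> trace h KL(1) K(2) KL(2) hL])
    qed
    then obtain g where g: "\<And>y. y \<in> topspace Y1 \<Longrightarrow> g y \<in> topspace Y2"
      and g\<phi>: "\<And>y V. y \<in> topspace Y1 \<Longrightarrow> V \<in> CO Y2 \<Longrightarrow> g y \<in> V \<longleftrightarrow> y \<in> \<phi> V"
      by metis
    have "continuous_map Y1 Y2 g"
    proof (rule continuous_map_into_zero_dimensional[OF Y2(1)])
      fix V assume V: "V \<in> CO Y2"
      have "openin Y1 (\<phi> V)"
        using \<phi>[OF V] by (simp add: CO_def)
      moreover from this have "{y \<in> topspace Y1. g y \<in> V} = \<phi> V"
        using g\<phi>[OF _ V] openin_subset by blast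
      ultimately show "openin Y1 {y \<in> topspace Y1. g y \<in> V}"
        by simp
    qed (use g in blast)
    moreover have "g (f1 x) = f2 (f x)" if x: "x \<in> topspace X1" for x
    proof (rule ccontr)
      have fx: "f1 x \<in> topspace Y1" "h x \<in> topspace Y2"
        using x f1 h by auto
      assume "g (f1 x) \<noteq> f2 (f x)"
      then have "g (f1 x) \<noteq> h x"
        by (simp add: h_def)
      \<comment> \<open>By the choice of \<open>g\<close> and by \<open>trace\<close>, a clopen set
        contains \<open>g (f1 x)\<close> exactly when it contains \<open>h x\<close>, so none can
        separate them.\<close>
      then obtain V where "V \<in> CO Y2" "g (f1 x) \<in> V" "h x \<notin> V"
        by (rule zero_dimensional_separates[OF Y2(1,3) g[OF fx(1)] fx(2)])
      then show False
        using g\<phi>[OF fx(1)] trace[OF _ x] by simp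
    qed
    ultimately show "\<exists>g. continuous_map Y1 Y2 g \<and> (\<forall>x\<in>topspace X1. g (f1 x) = f2 (f x))"
      by blast
  qed
qed

end
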